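(* Let $s\ge 1$. Let $Z$ be a nonzero west-facing zonal flow on $M_s$ and let $a\in\mathbb{R}_{>0}$. Then $$MC^{\mathfrak g\oplus\mathbb R}_{(Z,a),(Y,b)}\ >\ MC^{\mathfrak g}_{Z,Y}$$ for any $(Y,b)\in\mathfrak g\oplus\mathbb R$.
   Context: For $s\ge1$, $M_s:=\{(x,y,z)\in\mathbb R^3: x^2+y^2=s^2(1-z^2)\}$ (so $M_1=S^2$), with the Riemannian metric $g$ induced from $\mathbb R^3$ and the Riemannian volume form $\mu$, oriented so that in coordinates (longitude $\theta$, arc length $r$ along meridians increasing with $z$) $\mu$ is a positive multiple of $d\theta\wedge dr$ (the outward orientation). $\mathfrak g$ is the space of smooth divergence-free vector fields on $M_s$, with the usual commutator bracket $[X,Y]$ of vector fields and inner product $\langle X,Y\rangle=\int_{M_s} g(X,Y)\,\mu$. Let $\eta:=z\mu$ and $\Omega(X,Y):=\int_{M_s}\eta(X,Y)\,\mu$, i.e. $\Omega(X,Y)=\int_{M_s} z\,\mu(X,Y)\,\mu$, a 2-cocycle on $\mathfrak g$. The space $\mathfrak g\oplus\mathbb R$ carries the Lie bracket $[(X,a),(Y,b)]=([X,Y],\Omega(X,Y))$ and the inner product $\langle (X,a),(Y,b)\rangle=\langle X,Y\rangle+ab$. It is the tangent space at the identity (Lie algebra) of a central extension of the identity component of the group of volume-preserving diffeomorphisms of $M_s$. For a Lie algebra $\mathfrak h$ with inner product $\langle\,,\rangle$ and norm $\|\cdot\|$, the Misiołek curvature of $X,Y\in\mathfrak h$ is $MC^{\mathfrak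 h}_{X,Y}:=-\|[X,Y]\|^2-\langle X,[[X,Y],Y]\rangle$. It is used with $\mathfrak h=\mathfrak g$ and $\mathfrak h=\mathfrak g\oplus\mathbb R$. A zonal flow on $M_s$ is a vector field of the form $Z=F(z)(x\partial_y-y\partial_x)$ for some function $F$; it is called west-facing if $F\le 0$.
   Formalization: The formal theorem additionally assumes that [Z,Y] is not identically zero on M_s; without this the strict inequality fails (for example Y = 0 or Y = Z gives equality), and it fails for every Y commuting with Z. *)

theory Defs
  imports "HOL-Analysis.Analysis"
begin

section \<open>The spheroid and its vector fields\<close>

definition spheroid :: "real \<Rightarrow> (real^3) set" where
  "spheroid s = {p. (p$1)^2 + (p$2)^2 = s^2 * (1 - (p$3)^2)}"

text \<open>Half the gradient of \<open>x\<^sup>2 + y\<^sup>2 + s\<^sup>2 z\<^sup>2\<close>, normalised.\<close>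

definition outward_normal :: "real \<Rightarrow> real^3 \<Rightarrow> real^3" where
  "outward_normal s p = sgn (vector [p$1, p$2, s^2 * p$3])"

definition tangent_space :: "real \<Rightarrow> real^3 \<Rightarrow> (real^3) set" where
  "tangent_space s p = {v. outward_normal s p \<bullet> v = 0}"

definition tangent_proj :: "real \<Rightarrow> real^3 \<Rightarrow> real^3 \<Rightarrow> real^3" where
  "tangent_proj s p v = v - (outward_normal s p \<bullet> v) *\<^sub>R outward_normal s p"

primrec Ck_on :: "nat \<Rightarrow> 'a::real_normed_vector set \<Rightarrow> ('a \<Rightarrow> 'b::real_normed_vector) \<Rightarrow> bool" where
  "Ck_on 0 U f \<longleftrightarrow> continuous_on U f"
| "Ck_on (Suc k) U f \<longleftrightarrow>
     (\<forall>x\<in>U. f differentiable (at x)) \<and>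
     (\<forall>v. Ck_on k U (\<lambda>x. frechet_derivative f (at x) v))"

definition smooth_on :: "'a::real_normed_vector set \<Rightarrow> ('a \<Rightarrow> 'b::real_normed_vector) \<Rightarrow> bool" where
  "smooth_on U f \<longleftrightarrow> (\<forall>k. Ck_on k U f)"

text \<open>
  Vector fields on the surface are functions on all of \<open>\<real>\<^sup>3\<close> of which only the values on the
  surface matter.  Smoothness on the surface means that the field locally extends to a smooth
  map on an open subset of \<open>\<real>\<^sup>3\<close>.
\<close>

definition smooth_vector_field :: "real \<Rightarrow> (real^3 \<Rightarrow> real^3) \<Rightarrow> bool" where
  "smooth_vector_field s X \<longleftrightarrow>
     (\<forall>p\<in>spheroid s. X p \<in> tangent_space s p) \<and>
     (\<forall>p\<in>spheroid s. \<exists>U G. open U \<and> p \<in> U \<and> smooth_on U G \<and> (\<forall>q\<in>U \<inter> spheroid s. X q = G q))"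

text \<open>
  The derivative of \<open>X\<close> within the surface is determined only on tangent vectors, so it is
  applied to tangent vectors only; there it agrees with the derivative of any smooth local
  extension of \<open>X\<close>.
\<close>

definition deriv_along :: "real \<Rightarrow> (real^3 \<Rightarrow> real^3) \<Rightarrow> real^3 \<Rightarrow> real^3 \<Rightarrow> real^3" where
  "deriv_along s X p v = frechet_derivative X (at p within spheroid s) v"

text \<open>
  The Riemannian divergence is the trace of \<open>v \<mapsto> \<nabla>\<^sub>v X\<close> on the tangent plane, where
  \<open>\<nabla>\<^sub>v X\<close> is the tangential part of the derivative of \<open>X\<close> along \<open>v\<close>.  Precomposing with
  the tangential projection turns it into a trace on \<open>\<real>\<^sup>3\<close>.
\<close>

definition divergence :: "real \<Rightarrow> (real^3 \<Rightarrow> real^3) \<Rightarrow> real^3 \<Rightarrow> real" where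
  "divergence s X p =
     (\<Sum>b\<in>Basis. tangent_proj s p (deriv_along s X p (tangent_proj s p b)) \<bullet> b)"

definition div_free_fields :: "real \<Rightarrow> (real^3 \<Rightarrow> real^3) set" where
  "div_free_fields s =
     {X. smooth_vector_field s X \<and> (\<forall>p\<in>spheroid s. divergence s X p = 0)}"

text \<open>The commutator, with the sign for which \<open>[X,Y]f = X(Yf) - Y(Xf)\<close>.\<close>

definition lie_bracket ::
    "real \<Rightarrow> (real^3 \<Rightarrow> real^3) \<Rightarrow> (real^3 \<Rightarrow> real^3) \<Rightarrow> (real^3 \<Rightarrow> real^3)" where
  "lie_bracket s X Y = (\<lambda>p. deriv_along s Y p (X p) - deriv_along s X p (Y p))"


section \<open>The Riemannian volume and integration\<close>

text \<open>
  The Riemannian volume form for the outward orientation; eastward and northward vectors, in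
  this order, form a positive basis.
\<close>

definition vol_form :: "real \<Rightarrow> real^3 \<Rightarrow> real^3 \<Rightarrow> real^3 \<Rightarrow> real" where
  "vol_form s p v w = outward_normal s p \<bullet> cross3 v w"

text \<open>
  Integrals against the Riemannian volume are computed in the chart given by the longitude
  \<open>\<theta>\<close> and the parametric latitude \<open>t\<close>, which covers the surface once up to a null set.
\<close>

definition chart :: "real \<Rightarrow> real \<Rightarrow> real \<Rightarrow> real^3" where
  "chart s \<theta> t = vector [s * cos t * cos \<theta>, s * cos t * sin \<theta>, sin t]"

definition area_density :: "real \<Rightarrow> real \<Rightarrow> real \<Rightarrow> real" where
  "area_density s \<theta> t =
     norm (cross3 (vector_derivative (\<lambda>u. chart s u t) (at \<theta>))
                  (vector_derivative (\<lambda>u. chart s \<theta> u) (at t)))"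

definition surface_integral :: "real \<Rightarrow> (real^3 \<Rightarrow> real) \<Rightarrow> real" where
  "surface_integral s f =
     (LINT (\<theta>, t) : {0..2*pi} \<times> {-(pi/2)..pi/2} | lborel. f (chart s \<theta> t) * area_density s \<theta> t)"

definition L2_inner :: "real \<Rightarrow> (real^3 \<Rightarrow> real^3) \<Rightarrow> (real^3 \<Rightarrow> real^3) \<Rightarrow> real" where
  "L2_inner s X Y = surface_integral s (\<lambda>p. X p \<bullet> Y p)"


section \<open>The central extension and the curvature\<close>

definition cocycle :: "real \<Rightarrow> (real^3 \<Rightarrow> real^3) \<Rightarrow> (real^3 \<Rightarrow> real^3) \<Rightarrow> real" where
  "cocycle s X Y = surface_integral s (\<lambda>p. p$3 * vol_form s p (X p) (Y p))"

definition ext_bracket ::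
    "real \<Rightarrow> (real^3 \<Rightarrow> real^3) \<times> real \<Rightarrow> (real^3 \<Rightarrow> real^3) \<times> real \<Rightarrow> (real^3 \<Rightarrow> real^3) \<times> real" where
  "ext_bracket s V W = (lie_bracket s (fst V) (fst W), cocycle s (fst V) (fst W))"

definition ext_inner ::
    "real \<Rightarrow> (real^3 \<Rightarrow> real^3) \<times> real \<Rightarrow> (real^3 \<Rightarrow> real^3) \<times> real \<Rightarrow> real" where
  "ext_inner s V W = L2_inner s (fst V) (fst W) + snd V * snd W"

text \<open>The Misiolek curvature for a Lie bracket \<open>br\<close> and an inner product \<open>ip\<close>.\<close>

definition misiolek_curvature :: "('v \<Rightarrow> 'v \<Rightarrow> 'v) \<Rightarrow> ('v \<Rightarrow> 'v \<Rightarrow> real) \<Rightarrow> 'v \<Rightarrow> 'v \<Rightarrow> real" where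
  "misiolek_curvature br ip X Y = - ip (br X Y) (br X Y) - ip X (br (br X Y) Y)"


section \<open>Zonal flows\<close>

text \<open>
  The values of \<open>F\<close> outside \<open>[-1,1]\<close> are irrelevant, and so are those at \<open>\<plusminus>1\<close>, since the
  rotation field vanishes at the poles.
\<close>

definition zonal_flow_with :: "real \<Rightarrow> (real \<Rightarrow> real) \<Rightarrow> (real^3 \<Rightarrow> real^3) \<Rightarrow> bool" where
  "zonal_flow_with s F Z \<longleftrightarrow>
     smooth_vector_field s Z \<and> (\<forall>p\<in>spheroid s. Z p = F (p$3) *\<^sub>R vector [- p$2, p$1, 0])"

definition west_facing_zonal_flow :: "real \<Rightarrow> (real^3 \<Rightarrow> real^3) \<Rightarrow> bool" where
  "west_facing_zonal_flow s Z \<longleftrightarrow>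
     (\<exists>F. zonal_flow_with s F Z \<and> (\<forall>h\<in>{-1..1}. F h \<le> 0))"

text \<open>
  The two curvatures coincide for \<open>Y = Z\<close>, so a strict comparison between them needs an
  assumption that excludes fields \<open>Y\<close> commuting with \<open>Z\<close>.
\<close>

lemma misiolek_curvature_ext_self:
  "misiolek_curvature (ext_bracket s) (ext_inner s) (Z, a) (Z, b) =
   misiolek_curvature (lie_bracket s) (L2_inner s) Z Z"
  by (simp add: misiolek_curvature_def ext_bracket_def ext_inner_def cocycle_def
      lie_bracket_def vol_form_def surface_integral_def
      set_lebesgue_integral_def case_prod_unfold)

end

theory Submission
  imports Defs
begin

text \<open>
  By bilinearity the difference of the two curvatures is \<open>- \<Omega>(Z, Y)\<^sup>2 - a \<Omega>([Z, Y], Y)\<close>.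
  In longitude \<open>\<theta>\<close> and parametric latitude \<open>t\<close> the field \<open>Z\<close> depends on \<open>t\<close> only, so
  \<open>\<Omega>(Z, Y)\<close> is an integral over \<open>t\<close> of multiples of the flux of \<open>Y\<close> through the circles of
  latitude, and these fluxes vanish.  Integrating by parts, first in \<open>\<theta>\<close> and then, after using
  the divergence equation, in \<open>t\<close>, turns \<open>\<Omega>([Z, Y], Y)\<close> into the integral of a nonnegative
  weight times \<open>F (Y\<^sub>z)\<^sup>2\<close>, which is at most \<open>0\<close> for a west-facing flow.  If it is \<open>0\<close>, then
  \<open>F Y\<^sub>z\<close> vanishes.  Where \<open>F \<noteq> 0\<close>, the field \<open>Y\<close> is then itself locally zonal; where \<open>F = 0\<close>,
  also \<open>F' = 0\<close> because \<open>F\<close> has a maximum there.  In both cases \<open>[Z, Y] = 0\<close> away from the poles,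
  hence everywhere by continuity.
\<close>

section \<open>Differentiation along the surface\<close>

text \<open>\<open>sgn\<close> rescales the gradient by a positive factor, or leaves it 0 if it is
  0, so orthogonality can be tested against the gradient itself.\<close>

lemma tangent_space_iff:
  "v \<in> tangent_space s p \<longleftrightarrow> p$1 * v$1 + p$2 * v$2 + s^2 * p$3 * v$3 = 0"
proof -
  let ?N = "vector [p$1, p$2, s^2 * p$3] :: real^3"
  have "v \<in> tangent_space s p \<longleftrightarrow> inverse (norm ?N) * (?N \<bullet> v) = 0"
    by (simp add: tangent_space_def outward_normal_def sgn_div_norm divide_inverse)
  also have "\<dots> \<longleftrightarrow> ?N \<bullet> v = 0"
    by (cases "?N = 0") auto
  finally show ?thesis
    by (simp add: inner_vec_def sum_3)
qed

text \<open>The order-one case of \<open>smooth_on\<close>. The continuity is per direction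
  \<open>v\<close>, which is why \<open>continuous_on_deriv_along\<close> has to expand in a
  basis.\<close>

lemma smooth_vector_field_local_extension:
  assumes "smooth_vector_field s X" "p \<in> spheroid s"
  obtains U G where "open U" "p \<in> U" "\<And>q. q \<in> U \<Longrightarrow> G differentiable (at q)"
    "\<And>v. continuous_on U (\<lambda>q. frechet_derivative G (at q) v)"
    "\<And>q. q \<in> U \<inter> spheroid s \<Longrightarrow> X q = G q"
proof -
  obtain U G where UG: "open U" "p \<in> U" "smooth_on U G" "\<forall>q\<in>U \<inter> spheroid s. X q = G q"
    using assms unfolding smooth_vector_field_def by blast
  from UG(3) have "Ck_on (Suc 0) U G"
    unfolding smooth_on_def by blast
  with UG that[of U G] show thesis
    by simp
qed

lemma has_derivative_within_spheroid_transfer: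
  assumes "open U" "p \<in> U" "p \<in> spheroid s" "\<And>q. q \<in> U \<inter> spheroid s \<Longrightarrow> X q = G q"
    "(G has_derivative D) (at p)"
  shows "(X has_derivative D) (at p within spheroid s)"
proof -
  obtain d where d: "d > 0" "ball p d \<subseteq> U"
    using assms(1,2) openE by blast
  show ?thesis
  proof (rule has_derivative_transform_within[OF has_derivative_at_withinI[OF assms(5)] d(1) assms(3)])
    fix q assume "q \<in> spheroid s" "dist q p < d"
    then show "G q = X q"
      using d assms(4)[of q] by (auto simp: dist_commute subset_eq)
  qed
qed

text \<open>\<open>frechet_derivative\<close> is a choice that is meaningful only where a derivative
  exists; the local extension provides one.\<close>

lemma smooth_vector_field_has_derivative:
  assumes "smooth_vector_field s X" "p \<in> spheroid s"
  shows "(X has_derivative deriv_along s X p) (at p within spheroid s)"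
proof -
  obtain U G where UG: "open U" "p \<in> U" "\<And>q. q \<in> U \<Longrightarrow> G differentiable (at q)"
    "\<And>q. q \<in> U \<inter> spheroid s \<Longrightarrow> X q = G q"
    using smooth_vector_field_local_extension[OF assms] by metis
  have "(X has_derivative frechet_derivative G (at p)) (at p within spheroid s)"
    using UG assms frechet_derivative_works
    by (intro has_derivative_within_spheroid_transfer[of U]) auto
  then have "X differentiable (at p within spheroid s)"
    by (auto simp: differentiable_def)
  then show ?thesis
    by (simp add: deriv_along_def[abs_def] frechet_derivative_works)
qed

lemma linear_deriv_along:
  assumes "smooth_vector_field s X" "p \<in> spheroid s"
  shows "linear (deriv_along s X p)"
  using smooth_vector_field_has_derivative[OF assms] has_derivative_linear by blast

text \<open>Since the curve stays in \<open>S\<close>, a derivative within \<open>S\<close> suffices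
  for the chain rule.\<close>

lemma has_vector_derivative_within_compose:
  assumes "(X has_derivative D) (at (c x) within S)" "\<And>\<tau>. c \<tau> \<in> S"
    "(c has_vector_derivative v) (at x)"
  shows "((\<lambda>\<tau>. X (c \<tau>)) has_vector_derivative D v) (at x)"
proof -
  have "(X has_derivative D) (at (c x) within range c)"
    using assms(1,2) by (auto intro: has_derivative_subset)
  then show ?thesis
    using vector_derivative_diff_chain_within[OF assms(3), of X D] by (simp add: o_def)
qed

lemma tangent_curve:
  assumes "s \<ge> 1" "p \<in> spheroid s" "v \<in> tangent_space s p"
  obtains c where "c 0 = p" "\<And>\<tau>. c \<tau> \<in> spheroid s" "(c has_vector_derivative v) (at (0::real))"
proof -
  \<comment> \<open>\<open>c\<close> is the line \<open>p + \<tau> v\<close>, scaled back radially to the surface.\<close>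
  define k where "k = (v$1 / s)^2 + (v$2 / s)^2 + (v$3)^2"
  define r where "r \<tau> = 1 / sqrt (1 + \<tau>^2 * k)" for \<tau> :: real
  define c where "c \<tau> = r \<tau> *\<^sub>R (p + \<tau> *\<^sub>R v)" for \<tau>
  have "k \<ge> 0"
    by (simp add: k_def)
  then have pos: "1 + \<tau>^2 * k > 0" for \<tau> :: real
    by (simp add: add_pos_nonneg)
  have p: "(p$1)^2 + (p$2)^2 = s^2 * (1 - (p$3)^2)"
    using assms by (simp add: spheroid_def)
  have v: "p$1 * v$1 + p$2 * v$2 + s^2 * p$3 * v$3 = 0"
    using assms by (simp add: tangent_space_iff)
  have k: "s^2 * k = (v$1)^2 + (v$2)^2 + s^2 * (v$3)^2"
    using assms(1) by (simp add: k_def field_simps)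
  have c: "c \<tau> \<in> spheroid s" for \<tau>
  proof -
    have "(r \<tau>)^2 * (1 + \<tau>^2 * k) = 1"
      using pos[of \<tau>] by (simp add: r_def power_divide)
    \<comment> \<open>The cross term in \<tau> vanishes because \<open>v\<close> is tangent, so the
      line leaves the surface only to second order.\<close>
    moreover have "(p$1 + \<tau> * v$1)^2 + (p$2 + \<tau> * v$2)^2 + s^2 * (p$3 + \<tau> * v$3)^2
        = s^2 * (1 + \<tau>^2 * k)"
      using p v k by algebra
    ultimately show ?thesis
      unfolding spheroid_def c_def by simp algebra
  qed
  \<comment> \<open>\<open>r\<close> is even in \<tau>, so the rescaling does not change the
    velocity \<open>v\<close> at 0.\<close>
  have "(r has_real_derivative 0) (at 0)"
    unfolding r_def by (auto intro!: derivative_eq_intros)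
  then have "(c has_vector_derivative r 0 *\<^sub>R v + 0 *\<^sub>R (p + 0 *\<^sub>R v)) (at 0)"
    unfolding c_def by (auto intro!: derivative_eq_intros simp: has_real_derivative_iff_has_vector_derivative)
  then show thesis
    using that[of c] c by (simp add: c_def r_def)
qed

text \<open>The surface has empty interior in space, so a derivative within it is not unique as a
  linear map. Along a curve in the surface with velocity \<open>v\<close> it becomes a derivative in
  one real variable, which is unique.\<close>

lemma deriv_within_spheroid_unique_on_tangent:
  assumes "s \<ge> 1" "p \<in> spheroid s" "v \<in> tangent_space s p"
    "(X has_derivative D) (at p within spheroid s)" "(X has_derivative D') (at p within spheroid s)"
  shows "D v = D' v"
proof -
  obtain c where c: "c 0 = p" "\<And>\<tau>. c \<tau> \<in> spheroid s" "(c has_vector_derivative v) (at (0::real))"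
    using tangent_curve[OF assms(1-3)] by blast
  have "((\<lambda>\<tau>. X (c \<tau>)) has_vector_derivative D v) (at 0)"
    "((\<lambda>\<tau>. X (c \<tau>)) has_vector_derivative D' v) (at 0)"
    using assms(4,5) c by (auto intro!: has_vector_derivative_within_compose[of X _ c 0 "spheroid s"])
  then show ?thesis
    by (rule vector_derivative_unique_at)
qed

lemma continuous_on_deriv_along:
  fixes \<phi> w :: "'a::t2_space \<Rightarrow> real^3"
  assumes "s \<ge> 1" "smooth_vector_field s X" "continuous_on A \<phi>" "continuous_on A w"
    "\<And>x. x \<in> A \<Longrightarrow> \<phi> x \<in> spheroid s" "\<And>x. x \<in> A \<Longrightarrow> w x \<in> tangent_space s (\<phi> x)"
  shows "continuous_on A (\<lambda>x. deriv_along s X (\<phi> x) (w x))"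
  unfolding continuous_on_eq_continuous_within
proof
  fix x assume x: "x \<in> A"
  obtain U G where UG: "open U" "\<phi> x \<in> U" "\<And>q. q \<in> U \<Longrightarrow> G differentiable (at q)"
    "\<And>v. continuous_on U (\<lambda>q. frechet_derivative G (at q) v)"
    "\<And>q. q \<in> U \<inter> spheroid s \<Longrightarrow> X q = G q"
    using smooth_vector_field_local_extension[OF assms(2) assms(5)[OF x]] by metis
  \<comment> \<open>Continuity of the derivative of \<open>G\<close> is known for each fixed
    direction only, so the moving direction \<open>w y\<close> is expanded in the standard
    basis.\<close>
  define h where "h y = (\<Sum>i\<in>UNIV. w y $ i *\<^sub>R frechet_derivative G (at (\<phi> y)) (axis i 1))" for y
  have eq: "deriv_along s X (\<phi> y) (w y) = h y" if y: "y \<in> A" "\<phi> y \<in> U" for y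
  proof -
    have G: "(G has_derivative frechet_derivative G (at (\<phi> y))) (at (\<phi> y))"
      using UG(3)[OF y(2)] frechet_derivative_works by blast
    have "(X has_derivative frechet_derivative G (at (\<phi> y))) (at (\<phi> y) within spheroid s)"
      using has_derivative_within_spheroid_transfer[OF UG(1) y(2) assms(5)[OF y(1)] UG(5) G] by blast
    then have "deriv_along s X (\<phi> y) (w y) = frechet_derivative G (at (\<phi> y)) (w y)"
      using deriv_within_spheroid_unique_on_tangent assms y smooth_vector_field_has_derivative by blast
    also have "\<dots> = frechet_derivative G (at (\<phi> y)) (\<Sum>i\<in>UNIV. w y $ i *\<^sub>R axis i 1)"
      by (simp add: basis_expansion flip: scalar_mult_eq_scaleR)
    also have "\<dots> = h y"
      using has_derivative_linear[OF G] by (simp add: h_def linear_sum linear_cmul)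
    finally show ?thesis .
  qed
  have "continuous (at x within A) (\<lambda>y. frechet_derivative G (at (\<phi> y)) v)" for v
  proof (rule continuous_within_compose2[where g = "\<lambda>q. frechet_derivative G (at q) v"])
    show "continuous (at x within A) \<phi>"
      using assms(3) x by (simp add: continuous_on_eq_continuous_within)
    have "continuous (at (\<phi> x)) (\<lambda>q. frechet_derivative G (at q) v)"
      using UG(1,2,4) continuous_on_eq_continuous_at by blast
    then show "continuous (at (\<phi> x) within \<phi> ` A) (\<lambda>q. frechet_derivative G (at q) v)"
      using continuous_at_imp_continuous_within by blast
  qed
  moreover have "continuous (at x within A) w"
    using assms(4) x by (simp add: continuous_on_eq_continuous_within)
  ultimately have "continuous (at x within A) h"
    unfolding h_def by (intro continuous_intros)
  moreover have "\<forall>\<^sub>F y in at x within A. h y = deriv_along s X (\<phi> y) (w y)"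
  proof -
    have "\<forall>\<^sub>F y in at x within A. \<phi> y \<in> U"
      using assms(3) x UG(1,2) topological_tendstoD by (metis continuous_on_def)
    then show ?thesis
      using eq by (auto simp: eventually_at_filter elim!: eventually_mono)
  qed
  ultimately show "continuous (at x within A) (\<lambda>x. deriv_along s X (\<phi> x) (w x))"
    using eq[OF x UG(2)] unfolding continuous_within by (metis Lim_transform_eventually)
qed

lemma continuous_on_smooth_vector_field:
  assumes "smooth_vector_field s X"
  shows "continuous_on (spheroid s) X"
  unfolding continuous_on_eq_continuous_within
  using smooth_vector_field_has_derivative[OF assms] has_derivative_continuous by blast

section \<open>The chart by longitude and parametric latitude\<close>

lemma vector_3_expand:
  "(vector [x, y, z] :: real^3) = x *\<^sub>R axis 1 1 + y *\<^sub>R axis 2 1 + z *\<^sub>R axis 3 1"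
  by (simp add: vec_eq_iff forall_3 axis_def)

lemma continuous_on_vector_3 [continuous_intros]:
  assumes "continuous_on A f" "continuous_on A g" "continuous_on A h"
  shows "continuous_on A (\<lambda>x. vector [f x, g x, h x] :: real^3)"
  unfolding vector_3_expand by (intro continuous_intros assms)

lemma has_vector_derivative_vector_3:
  assumes "(f has_real_derivative f') F" "(g has_real_derivative g') F" "(h has_real_derivative h') F"
  shows "((\<lambda>x. vector [f x, g x, h x] :: real^3) has_vector_derivative vector [f', g', h']) F"
  unfolding vector_3_expand
  using assms unfolding has_real_derivative_iff_has_vector_derivative
  by (intro has_vector_derivative_add bounded_linear.has_vector_derivative[OF bounded_linear_scaleR_left])

section \<open>Coordinate vectors and cylindrical components\<close>

definition chart_dtheta :: "real \<Rightarrow> real \<Rightarrow> real \<Rightarrow> real^3" where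
  "chart_dtheta s \<theta> t = vector [- (s * cos t * sin \<theta>), s * cos t * cos \<theta>, 0]"

definition chart_dt :: "real \<Rightarrow> real \<Rightarrow> real \<Rightarrow> real^3" where
  "chart_dt s \<theta> t = vector [- (s * sin t * cos \<theta>), - (s * sin t * sin \<theta>), cos t]"

text \<open>The squared length of \<open>chart_dt\<close>, the velocity of the meridian ellipse in
  parametric latitude; it is constantly 1 on the round sphere.\<close>

definition meridian_speed_sq :: "real \<Rightarrow> real \<Rightarrow> real" where
  "meridian_speed_sq s t = s^2 * (sin t)^2 + (cos t)^2"

text \<open>With \<open>azimuthal\<close> and the third coordinate, these are the components in the
  orthonormal frame that turns with the longitude; in it the coordinate vectors of the chart have
  components independent of \<theta>.\<close>

definition radial :: "real \<Rightarrow> real^3 \<Rightarrow> real" where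
  "radial \<theta> v = v$1 * cos \<theta> + v$2 * sin \<theta>"

definition azimuthal :: "real \<Rightarrow> real^3 \<Rightarrow> real" where
  "azimuthal \<theta> v = - v$1 * sin \<theta> + v$2 * cos \<theta>"

lemma cylindrical_eqI:
  assumes "radial \<theta> v = radial \<theta> w" "azimuthal \<theta> v = azimuthal \<theta> w" "v$3 = w$3"
  shows "v = w"
proof -
  have *: "u$1 = radial \<theta> u * cos \<theta> - azimuthal \<theta> u * sin \<theta>"
    "u$2 = radial \<theta> u * sin \<theta> + azimuthal \<theta> u * cos \<theta>" for u
    using sin_cos_squared_add[of \<theta>] unfolding radial_def azimuthal_def by algebra+
  show ?thesis
    using assms *[of v] *[of w] by (simp add: vec_eq_iff forall_3)
qed

lemma cylindrical_linear:
  "radial \<theta> (v + w) = radial \<theta> v + radial \<theta> w" "azimuthal \<theta> (v + w) = azimuthal \<theta> v + azimuthal \<theta> w"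
  "radial \<theta> (v - w) = radial \<theta> v - radial \<theta> w" "azimuthal \<theta> (v - w) = azimuthal \<theta> v - azimuthal \<theta> w"
  "radial \<theta> (a *\<^sub>R v) = a * radial \<theta> v" "azimuthal \<theta> (a *\<^sub>R v) = a * azimuthal \<theta> v"
  by (simp_all add: radial_def azimuthal_def algebra_simps)

lemma radial_zero [simp]: "radial \<theta> 0 = 0" and azimuthal_zero [simp]: "azimuthal \<theta> 0 = 0"
  by (simp_all add: radial_def azimuthal_def)

lemma cylindrical_chart_dtheta:
  "radial \<theta> (chart_dtheta s \<theta> t) = 0" "azimuthal \<theta> (chart_dtheta s \<theta> t) = s * cos t"
  "chart_dtheta s \<theta> t $ 3 = 0"
  by (simp_all add: radial_def azimuthal_def chart_dtheta_def)
     (use sin_cos_squared_add[of \<theta>] in algebra)+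

lemma cylindrical_chart_dt:
  "radial \<theta> (chart_dt s \<theta> t) = - s * sin t" "azimuthal \<theta> (chart_dt s \<theta> t) = 0"
  "chart_dt s \<theta> t $ 3 = cos t"
  by (simp_all add: radial_def azimuthal_def chart_dt_def)
     (use sin_cos_squared_add[of \<theta>] in algebra)+

lemma inner_cylindrical:
  "v \<bullet> w = radial \<theta> v * radial \<theta> w + azimuthal \<theta> v * azimuthal \<theta> w + v$3 * w$3"
  using sin_cos_squared_add[of \<theta>]
  unfolding radial_def azimuthal_def inner_vec_def sum_3 inner_real_def by algebra

lemma meridian_speed_sq_pos: "s \<ge> 1 \<Longrightarrow> meridian_speed_sq s t > 0"
proof -
  assume "s \<ge> 1"
  then have "s^2 * (sin t)^2 \<ge> 1 * (sin t)^2"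
    by (intro mult_right_mono) (auto simp: one_le_power)
  then show ?thesis
    using sin_cos_squared_add[of t] unfolding meridian_speed_sq_def by linarith
qed

lemma chart_in_spheroid [simp]: "chart s \<theta> t \<in> spheroid s"
  unfolding spheroid_def chart_def
  by simp (use sin_cos_squared_add[of \<theta>] sin_cos_squared_add[of t] in algebra)

lemma has_vector_derivative_chart_theta:
  "((\<lambda>\<theta>. chart s \<theta> t) has_vector_derivative chart_dtheta s \<theta> t) (at \<theta>)"
  unfolding chart_def chart_dtheta_def
  by (rule has_vector_derivative_vector_3) (auto intro!: derivative_eq_intros)

lemma has_vector_derivative_chart_t:
  "(chart s \<theta> has_vector_derivative chart_dt s \<theta> t) (at t)"
  unfolding chart_def[abs_def] chart_dt_def
  by (rule has_vector_derivative_vector_3) (auto intro!: derivative_eq_intros)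

lemma continuous_on_chart [continuous_intros]:
  fixes f g :: "'a::t2_space \<Rightarrow> real"
  assumes "continuous_on A f" "continuous_on A g"
  shows "continuous_on A (\<lambda>x. chart s (f x) (g x))"
    "continuous_on A (\<lambda>x. chart_dtheta s (f x) (g x))" "continuous_on A (\<lambda>x. chart_dt s (f x) (g x))"
  unfolding chart_def chart_dtheta_def chart_dt_def
  by (intro continuous_intros assms)+

lemma continuous_on_cylindrical [continuous_intros]:
  fixes f :: "'a::t2_space \<Rightarrow> real"
  assumes "continuous_on A f" "continuous_on A v"
  shows "continuous_on A (\<lambda>x. radial (f x) (v x))" "continuous_on A (\<lambda>x. azimuthal (f x) (v x))"
  unfolding radial_def azimuthal_def
  by (intro continuous_intros assms)+

lemma tangent_space_chart_iff:
  assumes "s \<ge> 1"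
  shows "v \<in> tangent_space s (chart s \<theta> t) \<longleftrightarrow> cos t * radial \<theta> v + s * sin t * v$3 = 0"
proof -
  have "v \<in> tangent_space s (chart s \<theta> t) \<longleftrightarrow> s * (cos t * radial \<theta> v + s * sin t * v$3) = 0"
    unfolding tangent_space_iff chart_def radial_def by (simp add: algebra_simps power2_eq_square)
  then show ?thesis
    using assms by simp
qed

lemma chart_dtheta_tangent: "s \<ge> 1 \<Longrightarrow> chart_dtheta s \<theta> t \<in> tangent_space s (chart s \<theta> t)"
  and chart_dt_tangent: "s \<ge> 1 \<Longrightarrow> chart_dt s \<theta> t \<in> tangent_space s (chart s \<theta> t)"
  by (simp_all add: tangent_space_chart_iff cylindrical_chart_dtheta cylindrical_chart_dt)

text \<open>\<open>chart_dtheta\<close> vanishes at the poles, hence the condition on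
  \<open>cos t\<close>. The azimuthal and vertical components fix the two coefficients, and tangency
  then forces the radial component.\<close>

lemma tangent_chart_expand:
  assumes "s \<ge> 1" "cos t \<noteq> 0" "v \<in> tangent_space s (chart s \<theta> t)"
  shows "v = (azimuthal \<theta> v / (s * cos t)) *\<^sub>R chart_dtheta s \<theta> t + (v$3 / cos t) *\<^sub>R chart_dt s \<theta> t"
  using assms
  by (intro cylindrical_eqI[of \<theta>])
     (auto simp: cylindrical_linear cylindrical_chart_dtheta cylindrical_chart_dt
       tangent_space_chart_iff field_simps)

section \<open>Normal, volume form and area in the chart\<close>

lemma outward_normal_chart:
  assumes "s \<ge> 1"
  shows "outward_normal s (chart s \<theta> t) =
    (1 / sqrt (meridian_speed_sq s t)) *\<^sub>R vector [cos t * cos \<theta>, cos t * sin \<theta>, s * sin t]"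
proof -
  define N where "N = (vector [cos t * cos \<theta>, cos t * sin \<theta>, s * sin t] :: real^3)"
  have "vector [chart s \<theta> t $ 1, chart s \<theta> t $ 2, s^2 * chart s \<theta> t $ 3] = s *\<^sub>R N"
    by (simp add: N_def chart_def vec_eq_iff forall_3 power2_eq_square)
  moreover have "N \<bullet> N = meridian_speed_sq s t"
    unfolding N_def meridian_speed_sq_def
    by (simp add: inner_vec_def sum_3) (use sin_cos_squared_add[of \<theta>] in algebra)
  then have "norm N = sqrt (meridian_speed_sq s t)"
    by (simp add: norm_eq_sqrt_inner)
  ultimately show ?thesis
    using assms by (simp add: outward_normal_def sgn_div_norm N_def field_simps)
qed

lemma radial_normal_chart:
  assumes "s \<ge> 1"
  shows "radial \<theta> (outward_normal s (chart s \<theta> t)) = cos t / sqrt (meridian_speed_sq s t)"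
    "azimuthal \<theta> (outward_normal s (chart s \<theta> t)) = 0"
    "outward_normal s (chart s \<theta> t) $ 3 = s * sin t / sqrt (meridian_speed_sq s t)"
proof -
  have "radial \<theta> (vector [cos t * cos \<theta>, cos t * sin \<theta>, s * sin t]) = cos t"
    unfolding radial_def by simp (use sin_cos_squared_add[of \<theta>] in algebra)
  then show "radial \<theta> (outward_normal s (chart s \<theta> t)) = cos t / sqrt (meridian_speed_sq s t)"
    by (simp add: outward_normal_chart assms cylindrical_linear)
qed (simp_all add: outward_normal_chart assms cylindrical_linear azimuthal_def)

text \<open>The frame radial, azimuthal, vertical is orthonormal and positively oriented, so the
  usual coordinate formula holds in it.\<close>

lemma cross3_cylindrical:
  "radial \<theta> (cross3 v w) = azimuthal \<theta> v * w$3 - v$3 * azimuthal \<theta> w"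
  "azimuthal \<theta> (cross3 v w) = v$3 * radial \<theta> w - radial \<theta> v * w$3"
  "cross3 v w $ 3 = radial \<theta> v * azimuthal \<theta> w - azimuthal \<theta> v * radial \<theta> w"
  by (simp_all add: cross3_def radial_def azimuthal_def)
     (use sin_cos_squared_add[of \<theta>] in algebra)+

text \<open>The square root stands on the left because the area density contains the same root:
  their product in an integrand is free of roots.\<close>

lemma vol_form_chart:
  assumes "s \<ge> 1"
  shows "sqrt (meridian_speed_sq s t) * vol_form s (chart s \<theta> t) v w =
    cos t * (azimuthal \<theta> v * w$3 - v$3 * azimuthal \<theta> w)
    + s * sin t * (radial \<theta> v * azimuthal \<theta> w - azimuthal \<theta> v * radial \<theta> w)"
proof -
  define q where "q = sqrt (meridian_speed_sq s t)"
  have "q \<noteq> 0"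
    using meridian_speed_sq_pos[OF assms, of t] by (simp add: q_def)
  then show ?thesis
    by (simp add: vol_form_def inner_cylindrical[of _ _ \<theta>] radial_normal_chart[OF assms]
        cross3_cylindrical(1,2) cross3_cylindrical(3)[of _ _ \<theta>] field_simps flip: q_def)
qed

text \<open>The coordinate vectors are orthogonal, so the area is the product of their lengths;
  \<open>cos t \<ge> 0\<close> settles the sign of the root.\<close>

lemma area_density_eq:
  assumes "s \<ge> 1" "cos t \<ge> 0"
  shows "area_density s \<theta> t = s * cos t * sqrt (meridian_speed_sq s t)"
proof -
  let ?c = "cross3 (chart_dtheta s \<theta> t) (chart_dt s \<theta> t)"
  have "?c \<bullet> ?c = (s * cos t)^2 * meridian_speed_sq s t"
    by (simp add: inner_cylindrical[of _ _ \<theta>] cross3_cylindrical(1,2)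
        cross3_cylindrical(3)[of _ _ \<theta>] cylindrical_chart_dtheta
        cylindrical_chart_dt meridian_speed_sq_def power2_eq_square algebra_simps)
  then have "norm ?c = s * cos t * sqrt (meridian_speed_sq s t)"
    using assms by (simp add: norm_eq_sqrt_inner real_sqrt_mult)
  then show ?thesis
    by (simp add: area_density_def vector_derivative_at[OF has_vector_derivative_chart_theta]
        vector_derivative_at[OF has_vector_derivative_chart_t])
qed

lemma chart_surj:
  assumes "s \<ge> 1" "p \<in> spheroid s"
  obtains \<theta> t where "\<theta> \<in> {0..2*pi}" "t \<in> {-(pi/2)..pi/2}" "p = chart s \<theta> t"
proof -
  have p: "(p$1)^2 + (p$2)^2 = s^2 * (1 - (p$3)^2)"
    using assms by (simp add: spheroid_def)
  have "s^2 * (1 - (p$3)^2) \<ge> 0"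
    by (simp flip: p)
  then have z: "(p$3)^2 \<le> 1"
    using assms(1) by (simp add: zero_le_mult_iff)
  then have z': "-1 \<le> p$3" "p$3 \<le> 1"
    by (auto simp: abs_square_le_1 abs_le_iff)
  define t where "t = arcsin (p$3)"
  have t: "t \<in> {-(pi/2)..pi/2}" "sin t = p$3"
    using z' arcsin_bounded by (auto simp: t_def)
  have c: "(p$1)^2 + (p$2)^2 = (s * cos t)^2"
    using p t(2) sin_cos_squared_add[of t] by algebra
  obtain \<theta> where \<theta>: "0 \<le> \<theta>" "\<theta> \<le> 2 * pi" "p$1 = s * cos t * cos \<theta>" "p$2 = s * cos t * sin \<theta>"
  proof (cases "cos t = 0")
    \<comment> \<open>At a pole the longitude is arbitrary; 0 is taken.\<close>
    case True
    then show thesis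
      using c that[of 0] by (simp add: sum_power2_eq_zero_iff)
  next
    case False
    then have "(p$1 / (s * cos t))^2 + (p$2 / (s * cos t))^2 = 1"
      using c assms(1) by (simp add: power_divide flip: add_divide_distrib)
    then obtain \<theta> where "0 \<le> \<theta>" "\<theta> \<le> 2 * pi" "p$1 / (s * cos t) = cos \<theta>" "p$2 / (s * cos t) = sin \<theta>"
      using sincos_total_2pi_le by blast
    then show thesis
      using that[of \<theta>] False assms(1) by (simp add: field_simps)
  qed
  then show thesis
    using that[of \<theta> t] t by (simp add: chart_def vec_eq_iff forall_3)
qed

text \<open>Away from the poles the coordinate vectors are an orthogonal basis of the tangent plane,
  and this is the projection formula in such a basis.\<close>

lemma tangent_proj_chart:
  assumes "s \<ge> 1" "cos t \<noteq> 0"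
  shows "tangent_proj s (chart s \<theta> t) v =
    ((chart_dtheta s \<theta> t \<bullet> v) / (s * cos t)^2) *\<^sub>R chart_dtheta s \<theta> t
    + ((chart_dt s \<theta> t \<bullet> v) / meridian_speed_sq s t) *\<^sub>R chart_dt s \<theta> t"
proof -
  have q: "sqrt (meridian_speed_sq s t) * sqrt (meridian_speed_sq s t) = meridian_speed_sq s t" "meridian_speed_sq s t \<noteq> 0"
    using meridian_speed_sq_pos[OF assms(1), of t] by auto
  \<comment> \<open>\<open>Q\<close> stays folded while denominators are cleared and is unfolded
    only for the remaining polynomial identities.\<close>
  define Q where "Q = meridian_speed_sq s t"
  have Q: "Q = s * s * (sin t * sin t) + cos t * cos t" "Q \<noteq> 0"
    using q(2) by (simp_all add: Q_def meridian_speed_sq_def power2_eq_square)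
  show ?thesis
    unfolding tangent_proj_def using assms
    by (intro cylindrical_eqI[of \<theta>])
       (simp_all add: cylindrical_linear cylindrical_chart_dtheta cylindrical_chart_dt
         inner_cylindrical[of _ _ \<theta>] radial_normal_chart q power2_eq_square
         flip: Q_def, simp_all add: Q(2) divide_simps, simp_all add: Q(1), (simp add: algebra_simps)+)
qed

text \<open>A trace can be computed in any orthogonal basis of the tangent plane, each term being
  divided by a squared length.\<close>

lemma divergence_chart:
  assumes "s \<ge> 1" "cos t \<noteq> 0" "smooth_vector_field s X"
  shows "divergence s X (chart s \<theta> t) =
    (deriv_along s X (chart s \<theta> t) (chart_dtheta s \<theta> t) \<bullet> chart_dtheta s \<theta> t) / (s * cos t)^2
    + (deriv_along s X (chart s \<theta> t) (chart_dt s \<theta> t) \<bullet> chart_dt s \<theta> t) / meridian_speed_sq s t"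
proof -
  define e f where "e = chart_dtheta s \<theta> t" and "f = chart_dt s \<theta> t"
  define k l where "k = (s * cos t)^2" and "l = meridian_speed_sq s t"
  define D where "D = deriv_along s X (chart s \<theta> t)"
  have ee: "e \<bullet> e = k" and ff: "f \<bullet> f = l" and ef: "e \<bullet> f = 0"
    by (simp_all add: e_def f_def k_def l_def inner_cylindrical[of _ _ \<theta>] cylindrical_chart_dtheta
        cylindrical_chart_dt meridian_speed_sq_def power2_eq_square)
  have kl: "k \<noteq> 0" "l \<noteq> 0"
    using assms meridian_speed_sq_pos[OF assms(1), of t] by (auto simp: k_def l_def)
  have D: "linear D"
    using linear_deriv_along[OF assms(3)] by (simp add: D_def)
  have T: "tangent_proj s (chart s \<theta> t) v = ((e \<bullet> v) / k) *\<^sub>R e + ((f \<bullet> v) / l) *\<^sub>R f" for v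
    using tangent_proj_chart[OF assms(1,2)] by (simp add: e_def f_def k_def l_def)
  \<comment> \<open>Parseval's identity contracts the sums over the standard basis; the mixed terms
    then vanish because \<open>e \<bullet> f = 0\<close>.\<close>
  have S: "(\<Sum>b\<in>Basis. (u \<bullet> b) * (w \<bullet> b)) = u \<bullet> w" for u w :: "real^3"
    by (simp add: euclidean_inner[of u w])
  have "divergence s X (chart s \<theta> t) = (\<Sum>b\<in>Basis.
      (D e \<bullet> e) / k^2 * ((e \<bullet> b) * (e \<bullet> b)) + (D f \<bullet> e) / (k * l) * ((f \<bullet> b) * (e \<bullet> b))
      + (D e \<bullet> f) / (k * l) * ((e \<bullet> b) * (f \<bullet> b)) + (D f \<bullet> f) / l^2 * ((f \<bullet> b) * (f \<bullet> b)))"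
    unfolding divergence_def T D_def[symmetric]
    by (intro sum.cong refl)
       (simp add: linear_add[OF D] linear_cmul[OF D] inner_left_distrib inner_right_distrib
         inner_commute[of e] inner_commute[of f] kl field_simps power2_eq_square)
  also have "\<dots> = (D e \<bullet> e) / k^2 * (e \<bullet> e) + (D f \<bullet> e) / (k * l) * (f \<bullet> e)
      + (D e \<bullet> f) / (k * l) * (e \<bullet> f) + (D f \<bullet> f) / l^2 * (f \<bullet> f)"
    by (simp only: sum.distrib S flip: sum_distrib_left)
  also have "\<dots> = (D e \<bullet> e) / k + (D f \<bullet> f) / l"
    using kl by (simp add: ee ff ef inner_commute[of f e] power2_eq_square)
  finally show ?thesis
    by (simp add: D_def e_def f_def k_def l_def)
qed

text \<open>Once the root is absorbed the integrand is a continuous \<open>k\<close>, so the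
  Lebesgue integral becomes a Henstock-Kurzweil integral, to which the fundamental theorem and the
  Leibniz rule apply.\<close>

lemma surface_integral_eq:
  fixes k :: "real \<times> real \<Rightarrow> real"
  assumes "s \<ge> 1" "continuous_on UNIV k"
    and k: "\<And>\<theta> t. t \<in> {-(pi/2)..pi/2} \<Longrightarrow>
      f (chart s \<theta> t) * (s * cos t * sqrt (meridian_speed_sq s t)) = k (\<theta>, t)"
  shows "surface_integral s f = integral (cbox (0, -(pi/2)) (2*pi, pi/2)) k"
proof -
  let ?B = "cbox (0, -(pi/2)) (2*pi, pi/2) :: (real \<times> real) set"
  have "surface_integral s f = (LINT x : ?B | lborel. k x)"
    unfolding surface_integral_def cbox_Pair_eq box_real
    by (rule set_lebesgue_integral_cong)
       (auto simp: area_density_eq assms(1) cos_ge_zero k closed_Times intro!: borel_closed)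
  also have "\<dots> = integral ?B k"
    using borel_integrable_compact[OF compact_cbox continuous_on_subset[OF assms(2)]]
    by (intro set_borel_integral_eq_integral) (auto simp: set_integrable_def)
  finally show ?thesis .
qed

section \<open>Zonal flows and divergence-free fields in the chart\<close>

lemma has_real_derivative_nth:
  "(v has_vector_derivative v') F \<Longrightarrow> ((\<lambda>x. v x $ i) has_real_derivative v' $ i) F"
  unfolding has_real_derivative_iff_has_vector_derivative
  by (rule bounded_linear.has_vector_derivative[OF bounded_linear_vec_nth])

lemma has_real_derivative_cylindrical_fixed_frame:
  assumes "(v has_vector_derivative v') (at t)"
  shows "((\<lambda>t. radial \<theta> (v t)) has_real_derivative radial \<theta> v') (at t)"
    "((\<lambda>t. azimuthal \<theta> (v t)) has_real_derivative azimuthal \<theta> v') (at t)"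
  unfolding radial_def azimuthal_def
  by (auto intro!: derivative_eq_intros has_real_derivative_nth[OF assms])

text \<open>The extra terms come from the turning frame: the radial unit vector has the azimuthal
  one as its derivative, and the azimuthal one has minus the radial.\<close>

lemma has_real_derivative_cylindrical:
  assumes "(v has_vector_derivative v') (at \<theta>)"
  shows "((\<lambda>\<theta>. radial \<theta> (v \<theta>)) has_real_derivative radial \<theta> v' + azimuthal \<theta> (v \<theta>)) (at \<theta>)"
    "((\<lambda>\<theta>. azimuthal \<theta> (v \<theta>)) has_real_derivative azimuthal \<theta> v' - radial \<theta> (v \<theta>)) (at \<theta>)"
  unfolding radial_def azimuthal_def
  by (auto intro!: derivative_eq_intros has_real_derivative_nth[OF assms])

lemma cylindrical_azimuthal_unit:
  fixes \<theta> :: real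
  defines "e \<equiv> vector [- sin \<theta>, cos \<theta>, 0] :: real^3"
  shows "radial \<theta> e = 0" "azimuthal \<theta> e = 1" "e $ 3 = 0"
  using sin_cos_squared_add[of \<theta>] by (simp_all add: e_def radial_def azimuthal_def power2_eq_square)

lemma has_real_derivative_meridian_speed_sq:
  "(meridian_speed_sq s has_real_derivative 2 * (s^2 - 1) * sin t * cos t) (at t)"
  unfolding meridian_speed_sq_def[abs_def] by (auto intro!: derivative_eq_intros simp: algebra_simps)

lemma continuous_on_meridian_speed_sq [continuous_intros]:
  fixes f :: "'a::t2_space \<Rightarrow> real"
  assumes "continuous_on A f"
  shows "continuous_on A (\<lambda>x. meridian_speed_sq s (f x))"
  unfolding meridian_speed_sq_def by (intro continuous_intros assms)

lemma chart_2pi: "chart s (2 * pi) t = chart s 0 t"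
  by (simp add: chart_def)

lemma deriv_along_chart:
  assumes "smooth_vector_field s X"
  shows "((\<lambda>\<theta>. X (chart s \<theta> t)) has_vector_derivative
      deriv_along s X (chart s \<theta> t) (chart_dtheta s \<theta> t)) (at \<theta>)"
    "((\<lambda>t. X (chart s \<theta> t)) has_vector_derivative
      deriv_along s X (chart s \<theta> t) (chart_dt s \<theta> t)) (at t)"
  by (rule has_vector_derivative_within_compose[of X _ _ _ "spheroid s"];
      simp add: smooth_vector_field_has_derivative[OF assms] has_vector_derivative_chart_theta
        has_vector_derivative_chart_t)+

text \<open>The sign of \<open>F\<close> is not fixed here; it enters later, in the estimate of
  \<open>H\<close> and in the case of equality.\<close>

locale zonal_pair =
  fixes s :: real and F :: "real \<Rightarrow> real" and Z Y :: "real^3 \<Rightarrow> real^3"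
  assumes s_ge_1: "s \<ge> 1"
    and zonal: "zonal_flow_with s F Z"
    and div_free: "Y \<in> div_free_fields s"
begin

definition y :: "real \<Rightarrow> real \<Rightarrow> real^3" where
  "y \<theta> t = Y (chart s \<theta> t)"

text \<open>The partial derivatives of \<open>y\<close> are written through
  \<open>deriv_along\<close> so that \<open>continuous_on_deriv_along\<close> gives their joint
  continuity.\<close>

definition y\<theta> :: "real \<Rightarrow> real \<Rightarrow> real^3" where
  "y\<theta> \<theta> t = deriv_along s Y (chart s \<theta> t) (chart_dtheta s \<theta> t)"

definition yt :: "real \<Rightarrow> real \<Rightarrow> real^3" where
  "yt \<theta> t = deriv_along s Y (chart s \<theta> t) (chart_dt s \<theta> t)"

definition Yr :: "real \<Rightarrow> real \<Rightarrow> real" where "Yr \<theta> t = radial \<theta> (y \<theta> t)"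

definition Ya :: "real \<Rightarrow> real \<Rightarrow> real" where "Ya \<theta> t = azimuthal \<theta> (y \<theta> t)"

definition Yz :: "real \<Rightarrow> real \<Rightarrow> real" where "Yz \<theta> t = y \<theta> t $ 3"

text \<open>The signed speed of the zonal flow, so that the field is \<open>g t\<close> times the eastward unit vector.\<close>

definition g :: "real \<Rightarrow> real" where "g t = s * cos t * F (sin t)"

text \<open>The derivative of \<open>g\<close>, read off from \<open>Z\<close> on the meridian of
  longitude 0: its existence and continuity come from the smoothness of \<open>Z\<close>, while
  \<open>F\<close> is an arbitrary function.\<close>

definition g' :: "real \<Rightarrow> real" where
  "g' t = azimuthal 0 (deriv_along s Z (chart s 0 t) (chart_dt s 0 t))"

definition L :: "real \<Rightarrow> real \<Rightarrow> real^3" where "L \<theta> t = lie_bracket s Z Y (chart s \<theta> t)"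

lemma s_pos: "s > 0" and s_nz: "s \<noteq> 0"
  using s_ge_1 by auto

lemma smooth_Y: "smooth_vector_field s Y" and divergence_Y: "p \<in> spheroid s \<Longrightarrow> divergence s Y p = 0"
  using div_free by (auto simp: div_free_fields_def)

lemma smooth_Z: "smooth_vector_field s Z"
  using zonal by (simp add: zonal_flow_with_def)

lemma tangent_Y: "p \<in> spheroid s \<Longrightarrow> Y p \<in> tangent_space s p"
  and tangent_Z: "p \<in> spheroid s \<Longrightarrow> Z p \<in> tangent_space s p"
  using smooth_Y smooth_Z by (auto simp: smooth_vector_field_def)

lemma Z_chart: "Z (chart s \<theta> t) = g t *\<^sub>R vector [- sin \<theta>, cos \<theta>, 0]"
  using zonal chart_in_spheroid[of s \<theta> t]
  by (simp add: zonal_flow_with_def g_def) (simp add: chart_def vec_eq_iff forall_3)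

lemma y_theta: "((\<lambda>\<theta>. y \<theta> t) has_vector_derivative y\<theta> \<theta> t) (at \<theta>)"
  and y_t: "(y \<theta> has_vector_derivative yt \<theta> t) (at t)"
  using deriv_along_chart[OF smooth_Y] by (simp_all add: y_def[abs_def] y\<theta>_def yt_def)

lemma continuous_on_y [continuous_intros]:
  fixes f h :: "'a::t2_space \<Rightarrow> real"
  assumes [continuous_intros]: "continuous_on A f" "continuous_on A h"
  shows "continuous_on A (\<lambda>x. y (f x) (h x))" "continuous_on A (\<lambda>x. y\<theta> (f x) (h x))"
    "continuous_on A (\<lambda>x. yt (f x) (h x))"
proof -
  show "continuous_on A (\<lambda>x. y (f x) (h x))" unfolding y_def
    by (rule continuous_on_compose2[OF continuous_on_smooth_vector_field[OF smooth_Y]])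
       (auto intro!: continuous_intros)
  show "continuous_on A (\<lambda>x. y\<theta> (f x) (h x))" "continuous_on A (\<lambda>x. yt (f x) (h x))"
    unfolding y\<theta>_def yt_def
    by (intro continuous_on_deriv_along s_ge_1 smooth_Y continuous_intros chart_in_spheroid
        chart_dtheta_tangent chart_dt_tangent)+
qed

lemma continuous_on_Y_components [continuous_intros]:
  fixes f h :: "'a::t2_space \<Rightarrow> real"
  assumes [continuous_intros]: "continuous_on A f" "continuous_on A h"
  shows "continuous_on A (\<lambda>x. Yr (f x) (h x))" "continuous_on A (\<lambda>x. Ya (f x) (h x))"
    "continuous_on A (\<lambda>x. Yz (f x) (h x))"
  unfolding Yr_def Ya_def Yz_def by (intro continuous_intros)+

lemma continuous_on_L [continuous_intros]:
  fixes f h :: "'a::t2_space \<Rightarrow> real"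
  assumes [continuous_intros]: "continuous_on A f" "continuous_on A h"
  shows "continuous_on A (\<lambda>x. L (f x) (h x))"
proof -
  have *: "continuous_on A (\<lambda>x. X (chart s (f x) (h x)))" if "smooth_vector_field s X" for X
    by (rule continuous_on_compose2[OF continuous_on_smooth_vector_field[OF that]])
       (auto intro!: continuous_intros)
  show ?thesis
    unfolding L_def lie_bracket_def
    by (intro continuous_on_diff continuous_on_deriv_along s_ge_1 smooth_Y smooth_Z * continuous_intros
        chart_in_spheroid tangent_Y tangent_Z)
qed

lemma Y_deriv_theta:
  "((\<lambda>\<theta>. Yz \<theta> t) has_real_derivative y\<theta> \<theta> t $ 3) (at \<theta>)"
  "((\<lambda>\<theta>. Ya \<theta> t) has_real_derivative azimuthal \<theta> (y\<theta> \<theta> t) - Yr \<theta> t) (at \<theta>)"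
  "((\<lambda>\<theta>. Yr \<theta> t) has_real_derivative radial \<theta> (y\<theta> \<theta> t) + Ya \<theta> t) (at \<theta>)"
  unfolding Yz_def Ya_def Yr_def
  by (rule has_real_derivative_nth has_real_derivative_cylindrical y_theta)+

lemma Y_deriv_t:
  "(Yz \<theta> has_real_derivative yt \<theta> t $ 3) (at t)"
  "(Yr \<theta> has_real_derivative radial \<theta> (yt \<theta> t)) (at t)"
  unfolding Yz_def[abs_def] Yr_def[abs_def]
  by (rule has_real_derivative_nth has_real_derivative_cylindrical_fixed_frame y_t)+

lemma Y_2pi: "Yz (2 * pi) t = Yz 0 t" "Ya (2 * pi) t = Ya 0 t"
  by (simp_all add: Yz_def Ya_def y_def chart_2pi azimuthal_def)

section \<open>Tangency and divergence in components\<close>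

lemma tangency: "cos t * Yr \<theta> t + s * sin t * Yz \<theta> t = 0"
  using tangent_Y[OF chart_in_spheroid, of \<theta> t] tangent_space_chart_iff[OF s_ge_1]
  by (simp add: Yr_def Yz_def y_def)

text \<open>At a pole \<open>sin t\<close> is nonzero and tangency reduces to its term in
  \<open>Yz\<close>. This removes the boundary terms of the integrations in
  \<open>t\<close>.\<close>

lemma Yz_pole: "cos t = 0 \<Longrightarrow> Yz \<theta> t = 0"
  using tangency[of t \<theta>] sin_cos_squared_add[of t] s_nz by auto

text \<open>The identity \<open>tangency\<close> differentiated in \<theta>; \<open>Ya\<close>
  appears because the frame turns.\<close>

lemma tangency_theta: "cos t * (radial \<theta> (y\<theta> \<theta> t) + Ya \<theta> t) + s * sin t * y\<theta> \<theta> t $ 3 = 0"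
proof (rule DERIV_unique)
  show "((\<lambda>\<theta>. cos t * Yr \<theta> t + s * sin t * Yz \<theta> t) has_real_derivative
      cos t * (radial \<theta> (y\<theta> \<theta> t) + Ya \<theta> t) + s * sin t * y\<theta> \<theta> t $ 3) (at \<theta>)"
    by (auto intro!: derivative_eq_intros Y_deriv_theta)
qed (simp add: tangency)

text \<open>The identity \<open>tangency\<close> differentiated in \<open>t\<close>, where the frame
  is fixed.\<close>

lemma tangency_t:
  "cos t * radial \<theta> (yt \<theta> t) - sin t * Yr \<theta> t + s * cos t * Yz \<theta> t + s * sin t * yt \<theta> t $ 3 = 0"
proof (rule DERIV_unique)
  show "((\<lambda>t. cos t * Yr \<theta> t + s * sin t * Yz \<theta> t) has_real_derivative
      cos t * radial \<theta> (yt \<theta> t) - sin t * Yr \<theta> t + s * cos t * Yz \<theta> t + s * sin t * yt \<theta> t $ 3) (at t)"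
    by (auto intro!: derivative_eq_intros Y_deriv_t)
qed (simp add: tangency)

text \<open>The radial derivative in the divergence is eliminated by \<open>tangency_t\<close>. With
  Q = \<open>meridian_speed_sq s t\<close> the result reads Q d(Ya)/d\<theta> + s sqrt(Q) d(sqrt(Q)
  Yz)/dt = 0, whose first term integrates to 0 over a circle of latitude.\<close>

lemma div_chart:
  assumes "cos t \<noteq> 0"
  shows "meridian_speed_sq s t * (azimuthal \<theta> (y\<theta> \<theta> t) - Yr \<theta> t)
    + s * (s^2 - 1) * sin t * cos t * Yz \<theta> t + s * meridian_speed_sq s t * yt \<theta> t $ 3 = 0"
proof -
  define a r z where "a = azimuthal \<theta> (y\<theta> \<theta> t)" and "r = radial \<theta> (yt \<theta> t)" and "z = yt \<theta> t $ 3"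
  have "(a * (s * cos t)) / (s * cos t)^2 + (cos t * z - s * sin t * r) / meridian_speed_sq s t = 0"
    using divergence_Y[OF chart_in_spheroid[of s \<theta> t]] divergence_chart[OF s_ge_1 assms smooth_Y, of \<theta>]
    by (simp add: inner_cylindrical[of _ _ \<theta>] cylindrical_chart_dtheta cylindrical_chart_dt
        a_def r_def z_def algebra_simps flip: y\<theta>_def yt_def)
  then have "meridian_speed_sq s t * a + s * cos t * (cos t * z - s * sin t * r) = 0"
    using assms s_nz meridian_speed_sq_pos[OF s_ge_1, of t] by (simp add: field_simps power2_eq_square)
  moreover have "cos t * r - sin t * Yr \<theta> t + s * cos t * Yz \<theta> t + s * sin t * z = 0"
    using tangency_t by (simp add: r_def z_def)
  ultimately show ?thesis
    using tangency[of t \<theta>] unfolding meridian_speed_sq_def a_def[symmetric] z_def[symmetric] by algebra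
qed

section \<open>The zonal flow and its bracket with \<open>Y\<close>\<close>

lemma continuous_on_g' [continuous_intros]:
  fixes h :: "'a::t2_space \<Rightarrow> real"
  assumes [continuous_intros]: "continuous_on A h"
  shows "continuous_on A (\<lambda>x. g' (h x))"
proof -
  have "continuous_on A (\<lambda>x. deriv_along s Z (chart s 0 (h x)) (chart_dt s 0 (h x)))"
    by (intro continuous_on_deriv_along s_ge_1 smooth_Z continuous_intros chart_in_spheroid
        chart_dt_tangent)
  then show ?thesis
    unfolding g'_def by (intro continuous_intros)
qed

lemma g_deriv: "(g has_real_derivative g' t) (at t)"
proof -
  have "g = (\<lambda>t. azimuthal 0 (Z (chart s 0 t)))"
    by (simp add: Z_chart azimuthal_def)
  then show ?thesis
    using has_real_derivative_cylindrical_fixed_frame(2)[OF deriv_along_chart(2)[OF smooth_Z]]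
    by (simp add: g'_def)
qed

lemma continuous_on_g [continuous_intros]:
  fixes h :: "'a::t2_space \<Rightarrow> real"
  assumes "continuous_on A h"
  shows "continuous_on A (\<lambda>x. g (h x))"
  by (rule continuous_on_compose2[OF _ assms, of UNIV])
     (auto intro!: continuous_at_imp_continuous_on DERIV_isCont[OF g_deriv])

lemma Z_deriv_theta:
  "deriv_along s Z (chart s \<theta> t) (chart_dtheta s \<theta> t) = g t *\<^sub>R vector [- cos \<theta>, - sin \<theta>, 0]"
proof (rule vector_derivative_unique_at[OF deriv_along_chart(1)[OF smooth_Z]])
  have "((\<lambda>\<theta>. vector [- sin \<theta>, cos \<theta>, 0] :: real^3) has_vector_derivative vector [- cos \<theta>, - sin \<theta>, 0]) (at \<theta>)"
    by (rule has_vector_derivative_vector_3) (auto intro!: derivative_eq_intros)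
  then show "((\<lambda>\<theta>. Z (chart s \<theta> t)) has_vector_derivative g t *\<^sub>R vector [- cos \<theta>, - sin \<theta>, 0]) (at \<theta>)"
    unfolding Z_chart by (rule bounded_linear.has_vector_derivative[OF bounded_linear_scaleR_right])
qed

lemma Z_deriv_t:
  "deriv_along s Z (chart s \<theta> t) (chart_dt s \<theta> t) = g' t *\<^sub>R vector [- sin \<theta>, cos \<theta>, 0]"
proof (rule vector_derivative_unique_at[OF deriv_along_chart(2)[OF smooth_Z]])
  show "((\<lambda>t. Z (chart s \<theta> t)) has_vector_derivative g' t *\<^sub>R vector [- sin \<theta>, cos \<theta>, 0]) (at t)"
    unfolding Z_chart using g_deriv[unfolded has_real_derivative_iff_has_vector_derivative]
    by (rule bounded_linear.has_vector_derivative[OF bounded_linear_scaleR_left])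
qed

text \<open>Both fields are expanded in the coordinate vectors. The radial and vertical components
  are \<open>g t / (s * cos t)\<close> times the \<theta> derivatives of \<open>Yr\<close> and
  \<open>Yz\<close>; only the azimuthal one involves \<open>g'\<close>.\<close>

lemma bracket_chart:
  assumes "cos t \<noteq> 0"
  shows "radial \<theta> (L \<theta> t) = g t / (s * cos t) * (radial \<theta> (y\<theta> \<theta> t) + Ya \<theta> t)"
    "azimuthal \<theta> (L \<theta> t) = g t / (s * cos t) * azimuthal \<theta> (y\<theta> \<theta> t) - Yz \<theta> t / cos t * g' t"
    "L \<theta> t $ 3 = g t / (s * cos t) * y\<theta> \<theta> t $ 3"
proof -
  let ?p = "chart s \<theta> t"
  have Z: "Z ?p = (g t / (s * cos t)) *\<^sub>R chart_dtheta s \<theta> t"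
    using s_nz assms by (simp add: Z_chart chart_dtheta_def vec_eq_iff forall_3)
  have Y: "Y ?p = (Ya \<theta> t / (s * cos t)) *\<^sub>R chart_dtheta s \<theta> t + (Yz \<theta> t / cos t) *\<^sub>R chart_dt s \<theta> t"
    using tangent_chart_expand[OF s_ge_1 assms tangent_Y[OF chart_in_spheroid]]
    by (simp add: Ya_def Yz_def y_def)
  note linY = linear_cmul[OF linear_deriv_along[OF smooth_Y chart_in_spheroid]]
  note linZ = linear_add[OF linear_deriv_along[OF smooth_Z chart_in_spheroid]]
    linear_cmul[OF linear_deriv_along[OF smooth_Z chart_in_spheroid]]
  have L: "L \<theta> t = (g t / (s * cos t)) *\<^sub>R y\<theta> \<theta> t
      - (Ya \<theta> t / (s * cos t)) *\<^sub>R g t *\<^sub>R vector [- cos \<theta>, - sin \<theta>, 0]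
      - (Yz \<theta> t / cos t) *\<^sub>R g' t *\<^sub>R vector [- sin \<theta>, cos \<theta>, 0]"
    unfolding L_def lie_bracket_def Z Y linY linZ Z_deriv_theta Z_deriv_t y\<theta>_def[symmetric]
    by simp
  have "radial \<theta> (vector [- cos \<theta>, - sin \<theta>, 0]) = -1"
    unfolding radial_def by simp (use sin_cos_squared_add[of \<theta>] in algebra)
  then show "radial \<theta> (L \<theta> t) = g t / (s * cos t) * (radial \<theta> (y\<theta> \<theta> t) + Ya \<theta> t)"
    by (simp add: L cylindrical_linear cylindrical_azimuthal_unit algebra_simps)
  have "azimuthal \<theta> (vector [- cos \<theta>, - sin \<theta>, 0]) = 0"
    by (simp add: azimuthal_def)
  then show "azimuthal \<theta> (L \<theta> t) = g t / (s * cos t) * azimuthal \<theta> (y\<theta> \<theta> t) - Yz \<theta> t / cos t * g' t"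
    by (simp add: L cylindrical_linear cylindrical_azimuthal_unit)
  show "L \<theta> t $ 3 = g t / (s * cos t) * y\<theta> \<theta> t $ 3"
    by (simp add: L)
qed

end

section \<open>Integration in the chart\<close>

lemma mem_box_Pair_real:
  "(x, y) \<in> box (a, c) (b, d) \<longleftrightarrow> x \<in> {a<..<b} \<and> y \<in> {c<..<d::real}" for x :: real
  by (auto simp: box_def Basis_prod_def)

text \<open>Longitude is made the inner variable, so that periodicity and vanishing flux can be used
  on each circle of latitude.\<close>

lemma integral_box_swap:
  fixes k :: "real \<times> real \<Rightarrow> real"
  assumes "continuous_on UNIV k"
  shows "integral (cbox (a, c) (b, d)) k = integral {c..d} (\<lambda>t. integral {a..b} (\<lambda>\<theta>. k (\<theta>, t)))"
proof -
  have k: "continuous_on (cbox (a, c) (b, d)) k"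
    using assms continuous_on_subset by blast
  then show ?thesis
    using integral_prod_continuous[OF k] integral_swap_continuous[of a c b d "\<lambda>x y. k (x, y)"]
    by simp
qed

lemma leibniz_rule_real:
  fixes f f' :: "real \<Rightarrow> real \<Rightarrow> real"
  assumes "\<And>\<theta> t. (f \<theta> has_real_derivative f' \<theta> t) (at t)"
    and f: "\<And>t. continuous_on {a..b} (\<lambda>\<theta>. f \<theta> t)"
    and f': "continuous_on UNIV (\<lambda>(t, \<theta>). f' \<theta> t)"
  shows "((\<lambda>t. integral {a..b} (\<lambda>\<theta>. f \<theta> t)) has_real_derivative
    integral {a..b} (\<lambda>\<theta>. f' \<theta> t)) (at t)"
  using leibniz_rule_field_derivative[of UNIV a b "\<lambda>t \<theta>. f \<theta> t" "\<lambda>t \<theta>. f' \<theta> t" t]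
    assms(1) integrable_continuous_real[OF f] continuous_on_subset[OF f']
  by simp

section \<open>Flux through circles of latitude and the cocycle of \<open>Z\<close> and
  \<open>Y\<close>\<close>

context zonal_pair
begin

text \<open>The flux of \<open>Y\<close> through a circle of latitude is
  \<open>s * sqrt (meridian_speed_sq s t)\<close> times this integral. By the divergence equation
  and periodicity it does not depend on \<open>t\<close>, and at the south pole it is 0.\<close>

lemma latitude_flux_zero:
  assumes "t \<in> {-(pi/2)..pi/2}"
  shows "integral {0..2*pi} (\<lambda>\<theta>. Yz \<theta> t) = 0"
proof -
  define W where "W t = integral {0..2*pi} (\<lambda>\<theta>. Yz \<theta> t)" for t
  define W' where "W' t = integral {0..2*pi} (\<lambda>\<theta>. yt \<theta> t $ 3)" for t
  have W: "(W has_real_derivative W' t) (at t)" for t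
    unfolding W_def[abs_def] W'_def
    by (rule leibniz_rule_real[OF Y_deriv_t(1)]) (auto simp: case_prod_unfold intro!: continuous_intros)
  \<comment> \<open>This is the squared flux up to the factor \<open>s^2\<close>; squaring removes
    the root.\<close>
  define E where "E t = meridian_speed_sq s t * (W t)^2" for t
  define E' where "E' t = 2 * W t * ((s^2 - 1) * sin t * cos t * W t + meridian_speed_sq s t * W' t)" for t
  have E: "(E has_real_derivative E' t) (at t)" for t
    unfolding E_def[abs_def] E'_def
    by (auto intro!: derivative_eq_intros W has_real_derivative_meridian_speed_sq
        simp: algebra_simps power2_eq_square)
  have E'_zero: "E' t = 0" if "t \<in> {-(pi/2)<..<pi/2}" for t
  proof -
    have c: "cos t \<noteq> 0"
      using that cos_gt_zero_pi[of t] by auto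
    \<comment> \<open>The integrand is the \<theta> derivative of the periodic function
      \<open>Ya\<close>.\<close>
    have "((\<lambda>\<theta>. azimuthal \<theta> (y\<theta> \<theta> t) - Yr \<theta> t) has_integral Ya (2*pi) t - Ya 0 t) {0..2*pi}"
      by (intro fundamental_theorem_of_calculus)
         (auto intro: has_field_derivative_at_within Y_deriv_theta
           simp flip: has_real_derivative_iff_has_vector_derivative)
    then have 1: "((\<lambda>\<theta>. azimuthal \<theta> (y\<theta> \<theta> t) - Yr \<theta> t) has_integral 0) {0..2*pi}"
      by (simp add: Y_2pi)
    have 2: "((\<lambda>\<theta>. Yz \<theta> t) has_integral W t) {0..2*pi}"
      and 3: "((\<lambda>\<theta>. yt \<theta> t $ 3) has_integral W' t) {0..2*pi}"
      unfolding W_def W'_def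
      by (auto intro!: integrable_integral integrable_continuous_real continuous_intros)
    have "((\<lambda>\<theta>. meridian_speed_sq s t * (azimuthal \<theta> (y\<theta> \<theta> t) - Yr \<theta> t)
        + s * (s^2 - 1) * sin t * cos t * Yz \<theta> t + s * meridian_speed_sq s t * yt \<theta> t $ 3) has_integral
        meridian_speed_sq s t * 0 + s * (s^2 - 1) * sin t * cos t * W t + s * meridian_speed_sq s t * W' t) {0..2*pi}"
      by (intro has_integral_add has_integral_mult_right 1 2 3)
    then have "meridian_speed_sq s t * 0 + s * (s^2 - 1) * sin t * cos t * W t + s * meridian_speed_sq s t * W' t = 0"
      unfolding div_chart[OF c] by (rule has_integral_unique) simp
    then have "s * ((s^2 - 1) * sin t * cos t * W t + meridian_speed_sq s t * W' t) = 0"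
      by (simp add: algebra_simps)
    then show ?thesis
      using s_nz by (simp add: E'_def)
  qed
  have pole: "E (-(pi/2)) = 0"
    by (simp add: E_def W_def Yz_pole)
  have "E t = E (-(pi/2))"
  proof (cases "t = -(pi/2)")
    case False
    show ?thesis
    proof (rule DERIV_isconst_end[where f = E])
      show "-(pi/2) < t"
        using False assms by auto
      show "continuous_on {-(pi/2)..t} E"
        by (auto intro!: continuous_at_imp_continuous_on DERIV_isCont[OF E])
      show "(E has_real_derivative 0) (at x)" if "-(pi/2) < x" "x < t" for x
        using E[of x] E'_zero[of x] that assms by simp
    qed
  qed simp
  then have "meridian_speed_sq s t * (W t)^2 = 0"
    unfolding pole by (simp add: E_def)
  then show ?thesis
    using meridian_speed_sq_pos[OF s_ge_1, of t] by (simp add: W_def)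
qed

text \<open>Tangency turns the integrand into a function of \<open>t\<close> times
  \<open>Yz\<close>, whose integral over each circle of latitude is 0.\<close>

lemma cocycle_zonal_zero: "cocycle s Z Y = 0"
proof -
  define k where "k = (\<lambda>(\<theta>, t). s * meridian_speed_sq s t * sin t * g t * Yz \<theta> t)"
  have k: "continuous_on UNIV k"
    unfolding k_def case_prod_unfold by (intro continuous_intros)
  have "cocycle s Z Y = integral (cbox (0, -(pi/2)) (2*pi, pi/2)) k"
    unfolding cocycle_def
  proof (rule surface_integral_eq[OF s_ge_1 k])
    fix \<theta> t
    let ?p = "chart s \<theta> t" and ?q = "sqrt (meridian_speed_sq s t)"
    have "?q * vol_form s ?p (Z ?p) (Y ?p) = cos t * (g t * Yz \<theta> t) - s * sin t * (g t * Yr \<theta> t)"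
      using vol_form_chart[OF s_ge_1, of t \<theta> "Z ?p" "Y ?p"]
      by (simp add: Z_chart cylindrical_linear cylindrical_azimuthal_unit Yz_def Yr_def y_def)
    moreover have "?p $ 3 = sin t"
      by (simp add: chart_def)
    ultimately have "?p $ 3 * vol_form s ?p (Z ?p) (Y ?p) * (s * cos t * ?q)
        = sin t * s * cos t * (cos t * (g t * Yz \<theta> t) - s * sin t * (g t * Yr \<theta> t))"
      by algebra
    also have "\<dots> = k (\<theta>, t)"
      using tangency[of t \<theta>] unfolding k_def prod.case meridian_speed_sq_def by algebra
    finally show "?p $ 3 * vol_form s ?p (Z ?p) (Y ?p) * (s * cos t * ?q) = k (\<theta>, t)" .
  qed
  also have "\<dots> = integral {-(pi/2)..pi/2} (\<lambda>t. integral {0..2*pi} (\<lambda>\<theta>. k (\<theta>, t)))"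
    by (rule integral_box_swap[OF k])
  also have "\<dots> = integral {-(pi/2)..pi/2} (\<lambda>t. 0)"
    by (rule integral_cong) (simp add: k_def latitude_flux_zero)
  finally show ?thesis
    by simp
qed

section \<open>The cocycle of the bracket and \<open>Y\<close>\<close>

text \<open>
  Up to derivatives of functions that are periodic in \<open>\<theta>\<close> or vanish at the poles, the integrand
  of the cocycle on \<open>[Z, Y]\<close> and \<open>Y\<close> is the following multiple of \<open>g t\<close>.
\<close>

definition H :: "real \<times> real \<Rightarrow> real" where
  "H = (\<lambda>(\<theta>, t). s * meridian_speed_sq s t * g t * (Yz \<theta> t)^2)"

lemma continuous_on_H: "continuous_on A H"
  unfolding H_def case_prod_unfold by (intro continuous_intros)

text \<open>With Q = \<open>meridian_speed_sq s t\<close>, the integrand \<open>I\<close> minus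
  \<open>H\<close> is the \<open>t\<close> derivative of Q g Yz Yr plus a function of
  \<open>t\<close> times the \<theta> derivative of Yz Ya. The latter integrates to 0 by
  periodicity, the former to values at the poles, where \<open>Yz\<close> is 0.\<close>

lemma cocycle_bracket: "cocycle s (lie_bracket s Z Y) Y = integral (cbox (0, -(pi/2)) (2*pi, pi/2)) H"
proof -
  let ?B = "cbox (0, -(pi/2)) (2*pi, pi/2) :: (real \<times> real) set"
  define I where "I = (\<lambda>(\<theta>, t). s * cos t * sin t *
    (cos t * (azimuthal \<theta> (L \<theta> t) * Yz \<theta> t - L \<theta> t $ 3 * Ya \<theta> t)
     + s * sin t * (radial \<theta> (L \<theta> t) * Ya \<theta> t - azimuthal \<theta> (L \<theta> t) * Yr \<theta> t)))"
  have I: "continuous_on A I" for A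
    unfolding I_def case_prod_unfold by (intro continuous_intros)
  have 1: "cocycle s (lie_bracket s Z Y) Y = integral ?B I"
    unfolding cocycle_def
  proof (rule surface_integral_eq[OF s_ge_1 I])
    fix \<theta> t
    let ?p = "chart s \<theta> t" and ?q = "sqrt (meridian_speed_sq s t)"
    have "?p $ 3 * vol_form s ?p (lie_bracket s Z Y ?p) (Y ?p) * (s * cos t * ?q)
        = s * cos t * sin t * (?q * vol_form s ?p (L \<theta> t) (Y ?p))"
      by (simp add: chart_def L_def)
    also have "\<dots> = I (\<theta>, t)"
      unfolding vol_form_chart[OF s_ge_1] by (simp add: I_def Yz_def Ya_def Yr_def y_def)
    finally show "?p $ 3 * vol_form s ?p (lie_bracket s Z Y ?p) (Y ?p) * (s * cos t * ?q) = I (\<theta>, t)" .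
  qed
  define R where "R t = integral {0..2*pi} (\<lambda>\<theta>. Yz \<theta> t * Yr \<theta> t)" for t
  define R' where "R' t = integral {0..2*pi} (\<lambda>\<theta>. yt \<theta> t $ 3 * Yr \<theta> t + Yz \<theta> t * radial \<theta> (yt \<theta> t))" for t
  have R: "(R has_real_derivative R' t) (at t)" for t
    unfolding R_def[abs_def] R'_def
    by (rule leibniz_rule_real)
       (auto simp: case_prod_unfold intro!: continuous_intros derivative_eq_intros Y_deriv_t)
  define K where "K t = meridian_speed_sq s t * g t * R t" for t
  \<comment> \<open>The derivative of \<open>meridian_speed_sq s t * g t\<close>.\<close>
  define Qg' where "Qg' t = 2 * (s^2 - 1) * sin t * cos t * g t + meridian_speed_sq s t * g' t" for t
  have K: "(K has_real_derivative Qg' t * R t + meridian_speed_sq s t * g t * R' t) (at t)" for t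
    unfolding K_def[abs_def] Qg'_def
    by (auto intro!: derivative_eq_intros R g_deriv has_real_derivative_meridian_speed_sq simp: algebra_simps)
  define N where "N t = integral {0..2*pi} (\<lambda>\<theta>. I (\<theta>, t) - H (\<theta>, t))" for t
  have N: "N t = Qg' t * R t + meridian_speed_sq s t * g t * R' t" if "t \<in> {-(pi/2)<..<pi/2}" for t
  proof -
    have c: "cos t \<noteq> 0"
      using that cos_gt_zero_pi[of t] by auto
    \<comment> \<open>The \<theta> derivative of
      \<open>Yz \<theta> t * Ya \<theta> t\<close>.\<close>
    define P where "P \<theta> = y\<theta> \<theta> t $ 3 * Ya \<theta> t + Yz \<theta> t * (azimuthal \<theta> (y\<theta> \<theta> t) - Yr \<theta> t)" for \<theta>
    have "(P has_integral Yz (2*pi) t * Ya (2*pi) t - Yz 0 t * Ya 0 t) {0..2*pi}"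
    proof (intro fundamental_theorem_of_calculus)
      fix \<theta>
      have "((\<lambda>\<theta>. Yz \<theta> t * Ya \<theta> t) has_real_derivative P \<theta>) (at \<theta>)"
        unfolding P_def by (auto intro!: derivative_eq_intros Y_deriv_theta)
      then show "((\<lambda>\<theta>. Yz \<theta> t * Ya \<theta> t) has_vector_derivative P \<theta>) (at \<theta> within {0..2*pi})"
        using has_vector_derivative_at_within has_real_derivative_iff_has_vector_derivative by blast
    qed simp
    then have P: "(P has_integral 0) {0..2*pi}"
      by (simp add: Y_2pi)
    have R_int: "((\<lambda>\<theta>. Yz \<theta> t * Yr \<theta> t) has_integral R t) {0..2*pi}"
      and R'_int: "((\<lambda>\<theta>. yt \<theta> t $ 3 * Yr \<theta> t + Yz \<theta> t * radial \<theta> (yt \<theta> t)) has_integral R' t) {0..2*pi}"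
      unfolding R_def R'_def
      by (auto intro!: integrable_integral integrable_continuous_real continuous_intros)
    have "I (\<theta>, t) - H (\<theta>, t) = Qg' t * (Yz \<theta> t * Yr \<theta> t)
        + meridian_speed_sq s t * g t * (yt \<theta> t $ 3 * Yr \<theta> t + Yz \<theta> t * radial \<theta> (yt \<theta> t))
        + (- meridian_speed_sq s t * sin t * g t / cos t) * P \<theta>" for \<theta>
    proof -
      define Q where "Q = meridian_speed_sq s t"
      have Q: "Q = s^2 * (sin t)^2 + (cos t)^2"
        by (simp add: Q_def meridian_speed_sq_def)
      note br = bracket_chart[OF c, of \<theta>]
      \<comment> \<open>The bracket formulas are cleared of denominators, so that
        \<open>algebra\<close> meets only polynomial identities.\<close>
      have b1: "s * cos t * radial \<theta> (L \<theta> t) = g t * (radial \<theta> (y\<theta> \<theta> t) + Ya \<theta> t)"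
        and b2: "s * cos t * azimuthal \<theta> (L \<theta> t) = g t * azimuthal \<theta> (y\<theta> \<theta> t) - s * Yz \<theta> t * g' t"
        and b3: "s * cos t * L \<theta> t $ 3 = g t * y\<theta> \<theta> t $ 3"
        using c s_nz by (simp_all add: br field_simps)
      have "I (\<theta>, t) = sin t *
          (cos t * ((s * cos t * azimuthal \<theta> (L \<theta> t)) * Yz \<theta> t - (s * cos t * L \<theta> t $ 3) * Ya \<theta> t)
          + s * sin t * ((s * cos t * radial \<theta> (L \<theta> t)) * Ya \<theta> t
            - (s * cos t * azimuthal \<theta> (L \<theta> t)) * Yr \<theta> t))"
        by (simp add: I_def algebra_simps)
      \<comment> \<open>Tangency and its \<theta> derivative eliminate the radial components, and a
        factor \<open>Q\<close> comes out.\<close>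
      then have "cos t * I (\<theta>, t) = Q * sin t *
          ((g t * azimuthal \<theta> (y\<theta> \<theta> t) - s * Yz \<theta> t * g' t) * Yz \<theta> t - g t * y\<theta> \<theta> t $ 3 * Ya \<theta> t)"
        unfolding b1 b2 b3 Q using tangency[of t \<theta>] tangency_theta[of t \<theta>] by algebra
      \<comment> \<open>The divergence equation replaces the azimuthal derivative by the
        \<open>t\<close> derivative of \<open>Yz\<close>; together with \<open>tangency_t\<close>
        this assembles a full \<open>t\<close> derivative.\<close>
      then have "cos t * (I (\<theta>, t) - H (\<theta>, t)) = cos t * Qg' t * (Yz \<theta> t * Yr \<theta> t)
        + cos t * Q * g t * (yt \<theta> t $ 3 * Yr \<theta> t + Yz \<theta> t * radial \<theta> (yt \<theta> t))
        - Q * sin t * g t * P \<theta>"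
        using tangency[of t \<theta>] tangency_t[of t \<theta>] div_chart[OF c, of \<theta>]
        unfolding H_def P_def Qg'_def prod.case Q_def[symmetric] by algebra
      then show ?thesis
        using c by (simp add: field_simps Q_def)
    qed
    then have "((\<lambda>\<theta>. I (\<theta>, t) - H (\<theta>, t)) has_integral
        Qg' t * R t + meridian_speed_sq s t * g t * R' t + (- meridian_speed_sq s t * sin t * g t / cos t) * 0) {0..2*pi}"
      by (simp only:) (intro has_integral_add has_integral_mult_right R_int R'_int P)
    then show ?thesis
      by (simp add: N_def integral_unique)
  qed
  \<comment> \<open>\<open>N\<close> is known to be the derivative of \<open>K\<close> only strictly
    between the poles, because \<open>bracket_chart\<close> divides by \<open>cos t\<close>;
    continuity of \<open>K\<close> covers the ends.\<close>
  have "(N has_integral K (pi/2) - K (-(pi/2))) {-(pi/2)..pi/2}"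
  proof (rule fundamental_theorem_of_calculus_interior)
    show "continuous_on {-(pi/2)..pi/2} K"
      by (auto intro!: continuous_at_imp_continuous_on DERIV_isCont[OF K])
    show "(K has_vector_derivative N x) (at x)" if "x \<in> {-(pi/2)<..<pi/2}" for x
      using K N[OF that] by (simp add: has_real_derivative_iff_has_vector_derivative)
  qed simp
  then have "integral {-(pi/2)..pi/2} N = 0"
    by (simp add: integral_unique K_def R_def Yz_pole)
  then have "integral ?B (\<lambda>x. I x - H x) = 0"
    unfolding N_def by (simp add: integral_box_swap continuous_on_diff I continuous_on_H)
  then have "integral ?B I = integral ?B H"
    by (simp add: integral_diff integrable_continuous I continuous_on_H)
  then show ?thesis
    using 1 by simp
qed

section \<open>The case of equality: the bracket vanishes\<close>

lemma bracket_zero_interior: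
  assumes F: "\<And>h. h \<in> {-1..1} \<Longrightarrow> F h \<le> 0"
    and H: "\<And>x. x \<in> box (0, -(pi/2)) (2*pi, pi/2) \<Longrightarrow> H x = 0"
    and \<theta>: "\<theta> \<in> {0<..<2*pi}" and t: "t \<in> {-(pi/2)<..<pi/2}"
  shows "L \<theta> t = 0"
proof -
  have c: "cos t \<noteq> 0"
    using t cos_gt_zero_pi[of t] by auto
  have zero: "g t * Yz \<theta> t = 0" if "\<theta> \<in> {0<..<2*pi}" "t \<in> {-(pi/2)<..<pi/2}" for \<theta> t
    using H[of "(\<theta>, t)"] that s_nz meridian_speed_sq_pos[OF s_ge_1, of t]
    by (auto simp: H_def mem_box_Pair_real)
  show ?thesis
  proof (cases "g t = 0")
    case True
    \<comment> \<open>Between the poles \<open>cos t\<close> is positive, so \<open>g\<close>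
      inherits the sign of \<open>F\<close>.\<close>
    have nonpos: "g x \<le> 0" if "x \<in> {-(pi/2)<..<pi/2}" for x
      using F[of "sin x"] that s_pos cos_gt_zero_pi[of x]
      by (simp add: g_def mult_nonneg_nonpos)
    obtain d where d: "d > 0" "ball t d \<subseteq> {-(pi/2)<..<pi/2}"
      using openE[of "{-(pi/2)<..<pi/2}" t] t by auto
    \<comment> \<open>The nonpositive function \<open>g\<close> has a local maximum at its zero
      \<open>t\<close>.\<close>
    have "g' t = 0"
    proof (rule DERIV_local_max[OF g_deriv d(1)]; intro allI impI)
      fix x assume "\<bar>t - x\<bar> < d"
      then show "g x \<le> g t"
        using True nonpos d(2) by (auto simp: subset_eq dist_real_def)
    qed
    then show ?thesis
      using bracket_chart[OF c, of \<theta>] True by (intro cylindrical_eqI[of \<theta>]) simp_all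
  next
    case False
    \<comment> \<open>\<open>g\<close> is nonzero at \<open>t\<close> and, by continuity, at
      neighbouring latitudes. Hence \<open>Yz\<close> vanishes near the point in both variables, and
      both its partial derivatives are 0.\<close>
    have "\<forall>\<^sub>F x in nhds \<theta>. x \<in> {0<..<2*pi}"
      using \<theta> by (intro eventually_nhds_in_open) auto
    then have "\<forall>\<^sub>F x in nhds \<theta>. Yz x t = 0"
      by eventually_elim (use zero t False in auto)
    then have z\<theta>: "y\<theta> \<theta> t $ 3 = 0"
      using DERIV_cong_ev[of \<theta> \<theta> "\<lambda>\<theta>. Yz \<theta> t" "\<lambda>_. 0"] Y_deriv_theta(1)[of t \<theta>]
      by (metis DERIV_const DERIV_unique)
    have "\<forall>\<^sub>F x in nhds t. x \<in> {-(pi/2)<..<pi/2}"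
      using t by (intro eventually_nhds_in_open) auto
    moreover have "\<forall>\<^sub>F x in nhds t. g x \<noteq> 0"
    proof -
      have "continuous_on UNIV g"
        by (intro continuous_on_g continuous_intros)
      then have "open {x. g x \<noteq> 0}"
        by (simp add: open_Collect_neq)
      then show ?thesis
        using False eventually_nhds by blast
    qed
    ultimately have "\<forall>\<^sub>F x in nhds t. Yz \<theta> x = 0"
      by eventually_elim (use zero \<theta> in auto)
    then have zt: "yt \<theta> t $ 3 = 0"
      using DERIV_cong_ev[of t t "Yz \<theta>" "\<lambda>_. 0"] Y_deriv_t(1)[of \<theta> t]
      by (metis DERIV_const DERIV_unique)
    have z: "Yz \<theta> t = 0"
      using zero \<theta> t False by auto
    have r: "Yr \<theta> t = 0"
      using tangency[of t \<theta>] z c by simp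
    \<comment> \<open>With \<open>Yz\<close>, its \<open>t\<close> derivative and \<open>Yr\<close>
      zero, the divergence equation retains only the azimuthal derivative.\<close>
    have "azimuthal \<theta> (y\<theta> \<theta> t) = 0"
      using div_chart[OF c, of \<theta>] z zt r meridian_speed_sq_pos[OF s_ge_1, of t] by simp
    moreover have "radial \<theta> (y\<theta> \<theta> t) + Ya \<theta> t = 0"
      using tangency_theta[of t \<theta>] z\<theta> c by simp
    ultimately show ?thesis
      using bracket_chart[OF c, of \<theta>] z z\<theta> by (intro cylindrical_eqI[of \<theta>]) simp_all
  qed
qed

text \<open>\<open>L\<close> is continuous up to the poles, the closed box is the closure of the
  open one, and the chart maps it onto the surface.\<close>

lemma bracket_zero:
  assumes F: "\<And>h. h \<in> {-1..1} \<Longrightarrow> F h \<le> 0"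
    and H: "\<And>x. x \<in> box (0, -(pi/2)) (2*pi, pi/2) \<Longrightarrow> H x = 0"
    and p: "p \<in> spheroid s"
  shows "lie_bracket s Z Y p = 0"
proof -
  let ?S = "box (0, -(pi/2)) (2*pi, pi/2) :: (real \<times> real) set"
  have ne: "?S \<noteq> {}"
    by (auto simp: box_ne_empty Basis_prod_def)
  obtain \<theta> t where \<theta>t: "\<theta> \<in> {0..2*pi}" "t \<in> {-(pi/2)..pi/2}" "p = chart s \<theta> t"
    using chart_surj[OF s_ge_1 p] .
  have "(\<lambda>x. L (fst x) (snd x)) (\<theta>, t) = 0"
  proof (rule continuous_constant_on_closure[of ?S])
    show "continuous_on (closure ?S) (\<lambda>x. L (fst x) (snd x))"
      by (intro continuous_intros)
    show "L (fst x) (snd x) = 0" if "x \<in> ?S" for x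
      using that bracket_zero_interior[OF F H, of "fst x" "snd x"] by (cases x) (auto simp: mem_box_Pair_real)
    show "(\<theta>, t) \<in> closure ?S"
      using \<theta>t by (simp add: closure_box[OF ne] cbox_Pair_eq)
  qed
  then show ?thesis
    by (simp add: L_def \<theta>t)
qed

end

text \<open>The real component of the bracket is the cocycle: it adds its square to the norm term
  and pairs with \<open>a\<close> in the other. \<open>b\<close> disappears because the centre has
  trivial brackets.\<close>

lemma misiolek_curvature_ext:
  "misiolek_curvature (ext_bracket s) (ext_inner s) (X, a) (Y, b) =
   misiolek_curvature (lie_bracket s) (L2_inner s) X Y
   - (cocycle s X Y)^2 - a * cocycle s (lie_bracket s X Y) Y"
  by (simp add: misiolek_curvature_def ext_bracket_def ext_inner_def power2_eq_square)

theorem theorem1p2: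
  fixes s a b :: real and Z Y :: "real^3 \<Rightarrow> real^3"
  assumes "s \<ge> 1"
    and "west_facing_zonal_flow s Z"
    and "\<exists>p\<in>spheroid s. Z p \<noteq> 0"
    and "a > 0"
    and "Y \<in> div_free_fields s"
    and "\<exists>p\<in>spheroid s. lie_bracket s Z Y p \<noteq> 0"
  shows "misiolek_curvature (ext_bracket s) (ext_inner s) (Z, a) (Y, b) >
         misiolek_curvature (lie_bracket s) (L2_inner s) Z Y"
proof -
  obtain F where F: "zonal_flow_with s F Z" "\<And>h. h \<in> {-1..1} \<Longrightarrow> F h \<le> 0"
    using assms(2) by (auto simp: west_facing_zonal_flow_def)
  interpret zonal_pair s F Z Y
    by unfold_locales (use assms F in auto)
  let ?B = "cbox (0, -(pi/2)) (2*pi, pi/2) :: (real \<times> real) set"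
  let ?b = "box (0, -(pi/2)) (2*pi, pi/2) :: (real \<times> real) set"
  have H: "H x \<le> 0" if B: "x \<in> ?B" for x
  proof -
    obtain \<theta> t where x: "x = (\<theta>, t)" "t \<in> {-(pi/2)..pi/2}"
      using B by (cases x) (auto simp: cbox_Pair_eq)
    then have "g t \<le> 0"
      using F(2)[of "sin t"] s_pos cos_ge_zero[of t] by (simp add: g_def mult_nonneg_nonpos)
    then show ?thesis
      using s_pos meridian_speed_sq_pos[OF s_ge_1, of t]
      by (simp add: x H_def mult_nonneg_nonpos mult_nonpos_nonneg)
  qed
  have int: "H integrable_on ?B"
    by (intro integrable_continuous continuous_on_H)
  have "integral ?B H \<le> 0"
    using integral_le[OF int integrable_0 H] by simp
  moreover have "integral ?B H \<noteq> 0"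
  proof
    assume "integral ?B H = 0"
    \<comment> \<open>A continuous nonnegative function with integral 0 vanishes; the sign is
      changed to bring \<open>H\<close> into this form.\<close>
    then have "((\<lambda>x. - H x) has_integral 0) ?B"
      using has_integral_neg[OF integrable_integral[OF int]] by simp
    moreover have "?b \<noteq> {}"
      by (auto simp: box_ne_empty Basis_prod_def)
    ultimately have "- H x = 0" if "x \<in> ?b" for x
    proof (intro has_integral_0_cbox_imp_0[where f = "\<lambda>x. - H x"] continuous_on_minus continuous_on_H)
      show "0 \<le> - H z" if "z \<in> ?b" for z
        using H[of z] box_subset_cbox that by auto
      show "x \<in> ?B"
        using box_subset_cbox that by blast
    qed
    \<comment> \<open>This contradicts the hypothesis that \<open>Y\<close> does not commute with
      \<open>Z\<close>.\<close>
    then have "lie_bracket s Z Y p = 0" if "p \<in> spheroid s" for p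
      using bracket_zero[OF F(2)] that by simp
    then show False
      using assms(6) by blast
  qed
  ultimately have "a * integral ?B H < 0"
    using assms(4) by (simp add: mult_pos_neg)
  then show ?thesis
    by (simp add: misiolek_curvature_ext cocycle_zonal_zero cocycle_bracket)
qed

end
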